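(* Let $\mathcal{A}(s)=sE-A$ with $E,A\in\mathbb{C}^{n\times n}$ be a regular matrix pencil. Then for any matrix pencil $\mathcal{P}(s)=sF-G$, $F,G\in\mathbb{C}^{n\times n}$, of rank one such that $(\mathcal{A}+\mathcal{P})(s)$ is regular, we have for $\lambda\in\sigma(\mathcal{A})$ $$\dim \mathcal{L}_{\lambda}(\mathcal{A})-m_{1}(\lambda) \leq\dim \mathcal{L}_{\lambda}(\mathcal{A}+\mathcal{P}) \leq \dim \mathcal{L}_{\lambda}(\mathcal{A})+M(\mathcal{A})-m_{1}(\lambda),$$ whereas for $\lambda\in\overline{\mathbb{C}}\setminus\sigma(\mathcal{A})$ $$0\leq\dim\mathcal{L}_{\lambda}(\mathcal{A}+\mathcal{P})\leq M(\mathcal{A}).$$ Moreover, $$\sum_{\lambda\in\sigma(\mathcal{A})}\dim\mathcal{L}_{\lambda}(\mathcal{A}+\mathcal{P})\geq n-M(\mathcal{A}),\qquad \sum_{\lambda\in\sigma(\mathcal{A}+\mathcal{P})\setminus\sigma(\mathcal{A})}\dim\mathcal{L}_{\lambda}(\mathcal{A}+\mathcal{P}) \leq M(\mathcal{A}).$$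
   Context: $\overline{\mathbb{C}}:=\mathbb{C}\cup\{\infty\}$. A matrix pencil is $\mathcal{A}(s)=sE-A$ with $E,A\in\mathbb{C}^{n\times n}$; sums of pencils are formed pointwise. It is regular if $\det(sE-A)$ is not the zero polynomial. The rank of a pencil is the largest $r$ such that, viewed as a matrix with polynomial entries, it has an $r\times r$ minor that is not the zero polynomial. The spectrum $\sigma(\mathcal{A})\subseteq\overline{\mathbb{C}}$ consists of all $\lambda\in\mathbb{C}$ for which $\lambda E-A$ is singular, together with $\infty$ if $E$ is singular. Jordan chains: $\{g_0,\ldots,g_{m-1}\}\subset\mathbb{C}^n$ is a Jordan chain of length $m$ at $\lambda\in\mathbb{C}$ if $g_0\neq0$, $(A-\lambda E)g_0=0$ and $(A-\lambda E)g_j=Eg_{j-1}$ for $1\le j\le m-1$; it is a Jordan chain of length $m$ at $\infty$ if $g_0\neq0$, $Eg_0=0$ and $Eg_j=Ag_{j-1}$ for $1\le j\le m-1$. The root subspace $\mathcal{L}_\lambda(\mathcal{A})$, $\lambda\in\overline{\mathbb{C}}$, is the subspace consisting of the zero vector and all elements of all Jordan chains of $\mathcal{A}(s)$ at $\lambda$ (so it is $\{0\}$ if $\lambda\notin\sigma(\mathcal{A})$). For $\lambda\in\sigma(\mathcal{A})$, $m_1(\lambda)$ is the length of the longest Jordan chain of $\mathcal{A}(s)$ at $\lambda$, and $M(\mathcal{A}):=\sum_{\mu\in\sigma(\mathcal{A})}m_1(\mu)$. *)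

theory Defs
  imports "HOL-Analysis.Analysis" "HOL-Computational_Algebra.Polynomial"
begin

text \<open>
  The matrix pencil \<open>s E - A\<close> is represented by its pair of coefficient matrices
  \<open>E\<close>, \<open>A\<close>.  The dimension \<open>n\<close> is \<open>CARD('n)\<close>, and dimensions of subspaces of
  \<open>complex ^ 'n\<close> are taken over the complex field by \<^const>\<open>vec.dim\<close>.
\<close>

datatype ext_complex = Fin complex | Infty

definition pencil :: "complex^'n^'n \<Rightarrow> complex^'n^'n \<Rightarrow> complex poly^'n^'n" where
  "pencil E A = (\<chi> i j. monom (E $ i $ j) 1 - [:A $ i $ j:])"

lemma pencil_add: "pencil E A + pencil F G = pencil (E + F) (A + G)"
  by (simp add: pencil_def vec_eq_iff add_monom[symmetric])

definition regular_pencil :: "complex^'n^'n \<Rightarrow> complex^'n^'n \<Rightarrow> bool" where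
  "regular_pencil E A \<longleftrightarrow> det (pencil E A) \<noteq> 0"

text \<open>
  The \<open>r \<times> r\<close> minor with rows \<open>f 0, \<dots>, f (r - 1)\<close> and columns \<open>g 0, \<dots>, g (r - 1)\<close>.
  This is the defining expression of \<^const>\<open>det\<close>, with \<open>{..<r}\<close> in place of a finite
  index type, since \<open>r\<close> has to vary.  The index type \<open>'n\<close> carries no order, so rows and
  columns are selected by arbitrary injections; this affects only the sign.
\<close>

definition minor :: "'a::comm_ring_1^'n^'n \<Rightarrow> nat \<Rightarrow> (nat \<Rightarrow> 'n) \<Rightarrow> (nat \<Rightarrow> 'n) \<Rightarrow> 'a" where
  "minor M r f g =
     (\<Sum>p | p permutes {..<r}. of_int (sign p) * (\<Prod>i<r. M $ f i $ g (p i)))"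

text \<open>The injections bound \<open>r\<close> by the dimension and the empty minor is 1, so the maximum is taken over a finite set containing 0.\<close>

definition minor_rank :: "'a::comm_ring_1^'n^'n \<Rightarrow> nat" where
  "minor_rank M =
     Max {r. \<exists>f g. inj_on f {..<r} \<and> inj_on g {..<r} \<and> minor M r f g \<noteq> 0}"

definition pencil_rank :: "complex^'n^'n \<Rightarrow> complex^'n^'n \<Rightarrow> nat" where
  "pencil_rank E A = minor_rank (pencil E A)"

definition pencil_spectrum :: "complex^'n^'n \<Rightarrow> complex^'n^'n \<Rightarrow> ext_complex set" where
  "pencil_spectrum E A =
     {Fin \<mu> | \<mu>. \<not> invertible (mat \<mu> ** E - A)} \<union> (if invertible E then {} else {Infty})"

text \<open>
  \<open>jordan_chain E A \<mu> m g\<close>: the vectors \<open>g 0, \<dots>, g (m - 1)\<close> form a Jordan chain of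
  length \<open>m \<ge> 1\<close>; the values of \<open>g\<close> from \<open>m\<close> on are irrelevant.
\<close>

fun jordan_chain ::
  "complex^'n^'n \<Rightarrow> complex^'n^'n \<Rightarrow> ext_complex \<Rightarrow> nat \<Rightarrow> (nat \<Rightarrow> complex^'n) \<Rightarrow> bool" where
  "jordan_chain E A (Fin \<mu>) m g \<longleftrightarrow>
     1 \<le> m \<and> g 0 \<noteq> 0 \<and> (A - mat \<mu> ** E) *v g 0 = 0 \<and>
     (\<forall>j. 1 \<le> j \<and> j \<le> m - 1 \<longrightarrow> (A - mat \<mu> ** E) *v g j = E *v g (j - 1))"
| "jordan_chain E A Infty m g \<longleftrightarrow>
     1 \<le> m \<and> g 0 \<noteq> 0 \<and> E *v g 0 = 0 \<and>
     (\<forall>j. 1 \<le> j \<and> j \<le> m - 1 \<longrightarrow> E *v g j = A *v g (j - 1))"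

definition root_subspace ::
  "complex^'n^'n \<Rightarrow> complex^'n^'n \<Rightarrow> ext_complex \<Rightarrow> (complex^'n) set" where
  "root_subspace E A \<mu> = {0} \<union> {g j | g j m. jordan_chain E A \<mu> m g \<and> j < m}"

text \<open>
  For a regular pencil and \<open>\<mu>\<close> in the spectrum, the set below is finite and nonempty:
  the elements of a Jordan chain are then linearly independent.
\<close>

definition longest_chain :: "complex^'n^'n \<Rightarrow> complex^'n^'n \<Rightarrow> ext_complex \<Rightarrow> nat" where
  "longest_chain E A \<mu> = Max {m. \<exists>g. jordan_chain E A \<mu> m g}"

definition chain_sum :: "complex^'n^'n \<Rightarrow> complex^'n^'n \<Rightarrow> nat" where
  "chain_sum E A = (\<Sum>\<nu>\<in>pencil_spectrum E A. longest_chain E A \<nu>)"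

end

theory Submission
  imports Defs "HOL-Computational_Algebra.Fundamental_Theorem_Algebra"
    "HOL-Computational_Algebra.Polynomial_Factorial" "HOL-Computational_Algebra.Field_as_Ring"
begin

text \<open>
  Choose \<open>\<alpha>\<close> with \<open>R = \<alpha> E - A\<close> invertible and put \<open>T = R\<^sup>-\<^sup>1 E\<close>.  The root subspace at \<open>\<lambda> \<noteq> \<alpha>\<close> is the
  kernel of a high power of a linear polynomial \<open>q\<^sub>\<lambda>(T)\<close>, where the \<open>q\<^sub>\<lambda>\<close> are pairwise coprime.  Therefore
  the dimensions of the root subspaces add up to at most \<open>n\<close> over any finite set of points, and to at
  least \<open>n\<close> over the spectrum, because \<open>T\<close> is annihilated by a product of the \<open>q\<^sub>\<lambda>\<close>.

  If \<open>m\<close> is the length of the longest chain at \<open>\<lambda>\<close>, the root subspace is the kernel of \<open>N\<^sup>m\<close> for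
  \<open>N = q\<^sub>\<lambda>(T)\<close>.  A rank one pencil has either a common row or a common column factor, and in both cases
  there is a linear functional \<open>\<phi>\<close> such that the perturbed \<open>N'\<close> agrees with \<open>N\<close> at \<open>x\<close> whenever
  \<open>\<phi> x = \<phi> (N x) = 0\<close>.  So \<open>N'\<close> agrees with \<open>N\<close> on an \<open>N\<close>-invariant subspace of the kernel of \<open>N\<^sup>m\<close>
  of codimension at most \<open>m\<close>, and the root subspace loses at most \<open>m\<close> dimensions.  All other bounds
  follow by comparing with the total dimension \<open>n\<close>.
\<close>

section \<open>Kernels of matrix polynomials\<close>

text \<open>The vector p(T) x by Horner's scheme; acting on a vector avoids forming powers of the
  matrix T.\<close>

definition poly_apply :: "'a::field^'n^'n \<Rightarrow> 'a poly \<Rightarrow> 'a^'n \<Rightarrow> 'a^'n" where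
  "poly_apply T p x = fold_coeffs (\<lambda>a y. a *s x + T *v y) p 0"

lemma poly_apply_0 [simp]: "poly_apply T 0 x = 0"
  by (simp add: poly_apply_def)

lemma poly_apply_pCons [simp]:
  "poly_apply T (pCons a p) x = a *s x + T *v poly_apply T p x"
  by (cases "a = 0 \<and> p = 0") (auto simp: poly_apply_def)

lemma poly_apply_add: "poly_apply T (p + q) x = poly_apply T p x + poly_apply T q x"
  by (induction p q rule: poly_induct2)
     (simp_all add: matrix_vector_right_distrib vec.scale_left_distrib)

lemma poly_apply_smult: "poly_apply T (smult c p) x = c *s poly_apply T p x"
  by (induction p)
     (simp_all add: vec.scale_right_distrib vector_scalar_commute)

lemma poly_apply_diff: "poly_apply T (p - q) x = poly_apply T p x - poly_apply T q x"
  by (metis add_diff_cancel diff_add_cancel poly_apply_add)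

lemma poly_apply_1 [simp]: "poly_apply T 1 x = x"
  by (simp add: one_pCons)

lemma poly_apply_mult: "poly_apply T (p * q) x = poly_apply T p (poly_apply T q x)"
  by (induction p) (simp_all add: poly_apply_add poly_apply_smult)

lemma poly_apply_monom: "poly_apply T (monom c k) x = c *s ((*v) T ^^ k) x"
  by (induction k) (simp_all add: monom_0 monom_Suc vector_scalar_commute)

lemma poly_apply_sum: "poly_apply T (sum f I) x = (\<Sum>i\<in>I. poly_apply T (f i) x)"
  by (induction I rule: infinite_finite_induct) (simp_all add: poly_apply_add)

lemma poly_apply_power: "poly_apply T (p ^ k) x = (poly_apply T p ^^ k) x"
  by (induction k) (simp_all add: poly_apply_mult)

lemma poly_apply_add_right: "poly_apply T p (x + y) = poly_apply T p x + poly_apply T p y"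
  by (induction p) (simp_all add: matrix_vector_right_distrib vec.scale_right_distrib)

lemma poly_apply_scale_right: "poly_apply T p (c *s x) = c *s poly_apply T p x"
  by (induction p) (simp_all add: vector_scalar_commute vec.scale_right_distrib mult.commute)

lemma poly_apply_zero_right [simp]: "poly_apply T p 0 = 0"
  by (induction p) simp_all

definition poly_kernel :: "'a::field^'n^'n \<Rightarrow> 'a poly \<Rightarrow> ('a^'n) set" where
  "poly_kernel T p = {x. poly_apply T p x = 0}"

lemma subspace_poly_kernel: "vec.subspace (poly_kernel T p)"
  by (auto simp: poly_kernel_def vec.subspace_def poly_apply_add_right poly_apply_scale_right)

text \<open>By Bezout 1 = u p + v q. Hence the two kernels meet only in 0, and every vector killed
  by the product splits into one vector from each.\<close>

lemma dim_poly_kernel_mult: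
  fixes T :: "'a::{field_gcd}^'n^'n"
  assumes "coprime p q"
  shows "vec.dim (poly_kernel T (p * q)) = vec.dim (poly_kernel T p) + vec.dim (poly_kernel T q)"
proof -
  obtain u v where uv: "u * p + v * q = 1"
    using that bezout_coefficients_fst_snd[of p q] assms by simp
  have one: "x = poly_apply T (u * p) x + poly_apply T (v * q) x" for x
    using poly_apply_add[of T "u * p" "v * q" x] by (simp add: uv)
  have "poly_kernel T p \<inter> poly_kernel T q \<subseteq> {0}"
  proof
    fix x assume x: "x \<in> poly_kernel T p \<inter> poly_kernel T q"
    show "x \<in> {0}"
      using one[of x] x by (simp add: poly_kernel_def poly_apply_mult)
  qed
  then have zero: "vec.dim (poly_kernel T p \<inter> poly_kernel T q) = 0"
    by (simp only: vec.dim_eq_0)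
  have sum: "{x + y |x y. x \<in> poly_kernel T p \<and> y \<in> poly_kernel T q} = poly_kernel T (p * q)"
  proof (intro equalityI subsetI)
    fix z assume "z \<in> {x + y |x y. x \<in> poly_kernel T p \<and> y \<in> poly_kernel T q}"
    then obtain x y where z: "z = x + y" "poly_apply T p x = 0" "poly_apply T q y = 0"
      by (auto simp: poly_kernel_def)
    have "poly_apply T (p * q) x = 0"
      using z(2) by (metis mult.commute poly_apply_mult poly_apply_zero_right)
    moreover have "poly_apply T (p * q) y = 0"
      using z(3) by (simp add: poly_apply_mult)
    ultimately show "z \<in> poly_kernel T (p * q)"
      by (simp add: poly_kernel_def z poly_apply_add_right)
  next
    fix z assume "z \<in> poly_kernel T (p * q)"
    then have z: "poly_apply T (p * q) z = 0" by (simp add: poly_kernel_def)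
    \<comment> \<open>Polynomials in T commute, so q(T) applied to the first summand of z, and p(T)
      applied to the second, both pass through \<open>p * q\<close>, which kills z.\<close>
    have "poly_apply T (q * (u * p)) z = poly_apply T (u * (p * q)) z"
      "poly_apply T (p * (v * q)) z = poly_apply T (v * (p * q)) z"
      by (simp_all add: algebra_simps)
    then have "poly_apply T (u * p) z \<in> poly_kernel T q" "poly_apply T (v * q) z \<in> poly_kernel T p"
      using z by (simp_all add: poly_kernel_def poly_apply_mult)
    then show "z \<in> {x + y |x y. x \<in> poly_kernel T p \<and> y \<in> poly_kernel T q}"
      using one[of z] by (subst (asm) add.commute) blast
  qed
  show ?thesis
    using vec.dim_sums_Int[OF subspace_poly_kernel[of T p] subspace_poly_kernel[of T q]] zero
    unfolding sum by simp
qed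

lemma dim_poly_kernel_prod:
  fixes T :: "'a::{field_gcd}^'n^'n"
  assumes "finite S" "\<And>i j. i \<in> S \<Longrightarrow> j \<in> S \<Longrightarrow> i \<noteq> j \<Longrightarrow> coprime (q i) (q j)"
  shows "vec.dim (poly_kernel T (\<Prod>i\<in>S. q i)) = (\<Sum>i\<in>S. vec.dim (poly_kernel T (q i)))"
  using assms
proof (induction S rule: finite_induct)
  case empty
  have "poly_kernel T 1 = {0}" by (auto simp: poly_kernel_def)
  then show ?case by simp
next
  case (insert i S)
  have "coprime (q i) (\<Prod>j\<in>S. q j)"
    using insert.hyps by (intro prod_coprime_right insert.prems) auto
  then show ?case
    using insert by (simp add: dim_poly_kernel_mult)
qed

text \<open>The n + 1 vectors x, T x, ..., T^n x are dependent in dimension n; a nontrivial relation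
  supplies the coefficients of p.\<close>

lemma vector_annihilating_poly:
  fixes T :: "'a::field^'n^'n"
  shows "\<exists>p. p \<noteq> 0 \<and> poly_apply T p x = 0"
proof -
  let ?v = "\<lambda>i. ((*v) T ^^ i) x"
  let ?n = "CARD('n)"
  show ?thesis
  proof (cases "inj_on ?v {..?n}")
    \<comment> \<open>Dependence concerns the set of iterates and does not see a repetition; a
      repetition yields a binomial instead.\<close>
    case False
    then obtain i j where ij: "i \<noteq> j" "?v i = ?v j"
      by (auto simp: inj_on_def)
    let ?p = "monom 1 i - monom 1 j :: 'a poly"
    have "coeff ?p i \<noteq> 0" using ij(1) by simp
    then have "?p \<noteq> 0" by (metis coeff_0)
    moreover have "poly_apply T ?p x = 0"
      using ij by (simp add: poly_apply_diff poly_apply_monom)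
    ultimately show ?thesis by blast
  next
    case True
    have "vec.dependent (?v ` {..?n})"
    proof (rule ccontr)
      assume "\<not> vec.dependent (?v ` {..?n})"
      then have "card (?v ` {..?n}) \<le> vec.dim (UNIV :: ('a^'n) set)"
        by (intro vec.independent_card_le_dim) auto
      then show False using True by (simp add: card_image vec_dim_card card_cart_basis)
    qed
    then obtain u i where u: "(\<Sum>v\<in>?v ` {..?n}. u v *s v) = 0" and i: "i \<le> ?n" "u (?v i) \<noteq> 0"
      by (subst (asm) vec.dependent_finite) auto
    let ?p = "\<Sum>i\<le>?n. monom (u (?v i)) i"
    have "coeff ?p i \<noteq> 0"
      using i by (simp add: coeff_sum)
    then have "?p \<noteq> 0" by (metis coeff_0)
    moreover have "poly_apply T ?p x = 0"
      using u True by (simp add: poly_apply_sum poly_apply_monom sum.reindex)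
    ultimately show ?thesis by blast
  qed
qed

text \<open>Multiply polynomials that kill the basis vectors one at a time. The factors commute, so
  the one belonging to a given basis vector can act first.\<close>

lemma annihilating_poly:
  fixes T :: "'a::field^'n^'n"
  shows "\<exists>p. p \<noteq> 0 \<and> poly_kernel T p = UNIV"
proof -
  obtain p where p: "\<And>x. p x \<noteq> 0" "\<And>x. poly_apply T (p x) x = 0"
    using vector_annihilating_poly[of T] by metis
  let ?B = "cart_basis :: ('a^'n) set"
  let ?P = "\<Prod>b\<in>?B. p b"
  have "?B \<subseteq> poly_kernel T ?P"
  proof
    fix b assume "b \<in> ?B"
    then have "?P = (\<Prod>b\<in>?B - {b}. p b) * p b"
      by (metis finite_cart_basis mult.commute prod.remove)
    then show "b \<in> poly_kernel T ?P"
      by (simp add: poly_kernel_def poly_apply_mult p)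
  qed
  then have "vec.span ?B \<subseteq> poly_kernel T ?P"
    by (rule vec.span_minimal[OF _ subspace_poly_kernel])
  moreover have "?P \<noteq> 0"
    using p(1) by (simp add: finite_cart_basis)
  ultimately show ?thesis by (auto simp: top.extremum_unique)
qed

lemma poly_kernel_dvd:
  assumes "p dvd q"
  shows "poly_kernel T p \<subseteq> poly_kernel T q"
proof -
  obtain r where "q = r * p" using assms by (metis dvdE mult.commute)
  then show ?thesis by (auto simp: poly_kernel_def poly_apply_mult)
qed

section \<open>Iterated kernels under perturbation\<close>

text \<open>If \<phi> s is nonzero for some s in S, subtracting a multiple of s moves any vector of
  S into the kernel of \<phi>; so s and that kernel span S.\<close>

lemma dim_hyperplane_Int:
  fixes S :: "('a::field^'n) set" and \<phi> :: "'a^'n \<Rightarrow> 'a"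
  assumes "vec.subspace S" "Vector_Spaces.linear (*s) (*) \<phi>"
  shows "vec.dim S \<le> vec.dim {x \<in> S. \<phi> x = 0} + 1"
proof -
  interpret \<phi>: Vector_Spaces.linear "(*s)" "(*)" \<phi> by fact
  let ?U = "{x \<in> S. \<phi> x = 0}"
  show ?thesis
  proof (cases "?U = S")
    case False
    then obtain s where s: "s \<in> S" "\<phi> s \<noteq> 0" by blast
    have "S \<subseteq> vec.span (insert s ?U)"
    proof
      fix x assume x: "x \<in> S"
      let ?y = "x - (\<phi> x / \<phi> s) *s s"
      have "?y \<in> ?U"
        using s x assms(1) by (simp add: \<phi>.diff \<phi>.scale vec.subspace_diff vec.subspace_scale)
      then have "?y \<in> vec.span (insert s ?U)" "(\<phi> x / \<phi> s) *s s \<in> vec.span (insert s ?U)"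
        by (auto intro: vec.span_base vec.span_scale)
      then have "?y + (\<phi> x / \<phi> s) *s s \<in> vec.span (insert s ?U)"
        by (rule vec.span_add)
      then show "x \<in> vec.span (insert s ?U)" by simp
    qed
    then have "vec.dim S \<le> vec.dim (vec.span (insert s ?U))"
      by (rule vec.dim_subset)
    also have "\<dots> \<le> vec.dim ?U + 1"
      by (simp add: vec.dim_insert)
    finally show ?thesis .
  qed simp
qed

lemma funpow_matrix_linear:
  "Vector_Spaces.linear (*s) (*s) ((*v) (N::'a::field^'n^'n) ^^ k)"
proof (induction k)
  case 0
  then show ?case using vec.linear_id by (simp add: id_def)
next
  case (Suc k)
  then show ?case 
    by (metis Vector_Spaces.linear_compose funpow.simps(2) matrix_vector_mul_linear_gen)
qed

definition iter_kernel :: "'a::field^'n^'n \<Rightarrow> nat \<Rightarrow> ('a^'n) set" where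
  "iter_kernel N k = {x. ((*v) N ^^ k) x = 0}"

lemma subspace_iter_kernel: "vec.subspace (iter_kernel N k)"
proof -
  interpret Vector_Spaces.linear "(*s)" "(*s)" "(*v) N ^^ k" by (rule funpow_matrix_linear)
  show ?thesis by (simp add: iter_kernel_def vec.subspace_def add scale)
qed

lemma iter_kernel_Suc: "x \<in> iter_kernel N (Suc k) \<longleftrightarrow> N *v x \<in> iter_kernel N k"
  by (simp add: iter_kernel_def funpow_swap1)

lemma iter_kernel_mono: "j \<le> k \<Longrightarrow> iter_kernel N j \<subseteq> iter_kernel N k"
proof (induction rule: dec_induct)
  case (step k)
  then show ?case by (force simp: iter_kernel_def)
qed simp

lemma dim_iter_kernel_perturbation:
  fixes N N' :: "'a::field^'n^'n" and \<phi> :: "'a^'n \<Rightarrow> 'a"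
  assumes lin: "Vector_Spaces.linear (*s) (*) \<phi>"
    and agree: "\<And>x. \<phi> x = 0 \<Longrightarrow> \<phi> (N *v x) = 0 \<Longrightarrow> N' *v x = N *v x"
  shows "vec.dim (iter_kernel N m) \<le> vec.dim (iter_kernel N' m) + m"
proof -
  interpret \<phi>: Vector_Spaces.linear "(*s)" "(*)" \<phi> by fact
  \<comment> \<open>\<open>U j\<close> imposes the first j conditions on the orbit of x, each
    costing at most one dimension. \<open>U m\<close> is the subspace on which the two matrices have
    equal orbits.\<close>
  define U where "U j = {x \<in> iter_kernel N m. \<forall>i<j. \<phi> (((*v) N ^^ i) x) = 0}" for j
  have lin': "Vector_Spaces.linear (*s) (*) (\<lambda>x. \<phi> (((*v) N ^^ i) x))" for i
    using Vector_Spaces.linear_compose[OF funpow_matrix_linear lin] by (simp add: o_def)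
  have sub: "vec.subspace (U j)" for j
  proof -
    have "U j = iter_kernel N m \<inter> (\<Inter>i<j. {x. \<phi> (((*v) N ^^ i) x) = 0})"
      by (auto simp: U_def)
    moreover have "vec.subspace {x. \<phi> (((*v) N ^^ i) x) = 0}" for i
    proof -
      interpret l: Vector_Spaces.linear "(*s)" "(*)" "\<lambda>x. \<phi> (((*v) N ^^ i) x)" by (rule lin')
      show ?thesis by (rule l.subspace_kernel)
    qed
    ultimately show ?thesis
      using subspace_iter_kernel[of N m]
      by (auto simp add: vec.subspace_def)
  qed
  have "vec.dim (iter_kernel N m) \<le> vec.dim (U j) + j" for j
  proof (induction j)
    case 0
    then show ?case by (simp add: U_def)
  next
    case (Suc j)
    have "U (Suc j) = {x \<in> U j. \<phi> (((*v) N ^^ j) x) = 0}"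
      by (auto simp: U_def less_Suc_eq)
    then show ?case
      using Suc dim_hyperplane_Int[OF sub lin', of j j] by simp
  qed
  moreover have "U m \<subseteq> iter_kernel N' m"
  proof
    fix x assume x: "x \<in> U m"
    \<comment> \<open>From the exponent m on the iterates of x vanish, so m conditions control the
      whole orbit.\<close>
    have "\<phi> (((*v) N ^^ i) x) = 0" for i
    proof (cases "i < m")
      case False
      then have "((*v) N ^^ i) x = 0"
        using x iter_kernel_mono[of m i N] by (auto simp: U_def iter_kernel_def)
      then show ?thesis by (simp add: \<phi>.zero)
    qed (use x in \<open>simp add: U_def\<close>)
    then have "((*v) N' ^^ i) x = ((*v) N ^^ i) x" for i
    proof (induction i)
      case (Suc i)
      then show ?case
        using agree[of "((*v) N ^^ i) x"] by (metis comp_apply funpow.simps(2))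
    qed simp
    then show "x \<in> iter_kernel N' m"
      using x by (simp add: U_def iter_kernel_def)
  qed
  ultimately show ?thesis
    using vec.dim_subset by (meson add_le_mono1 order_trans)
qed

section \<open>Jordan chains\<close>

text \<open>
  A Jordan chain at any point of the extended plane has the form \<open>X g\<^sub>0 = 0\<close>, \<open>X g\<^sub>j = Y g\<^sub>j\<^sub>-\<^sub>1\<close>,
  with \<open>X\<close> the value of the pencil at the point, up to sign; together, \<open>X\<close> and \<open>Y\<close> span the pencil.
\<close>

fun point_kernel :: "complex^'n^'n \<Rightarrow> complex^'n^'n \<Rightarrow> ext_complex \<Rightarrow> complex^'n^'n" where
  "point_kernel E A (Fin \<mu>) = A - mat \<mu> ** E"
| "point_kernel E A Infty = E"

fun point_shift :: "complex^'n^'n \<Rightarrow> complex^'n^'n \<Rightarrow> ext_complex \<Rightarrow> complex^'n^'n" where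
  "point_shift E A (Fin \<mu>) = E"
| "point_shift E A Infty = A"

definition matrix_chain :: "'a::field^'n^'n \<Rightarrow> 'a^'n^'n \<Rightarrow> nat \<Rightarrow> (nat \<Rightarrow> 'a^'n) \<Rightarrow> bool" where
  "matrix_chain X Y m g \<longleftrightarrow> 1 \<le> m \<and> g 0 \<noteq> 0 \<and> X *v g 0 = 0 \<and>
     (\<forall>j. Suc j < m \<longrightarrow> X *v g (Suc j) = Y *v g j)"

lemma jordan_chain_iff:
  "jordan_chain E A \<mu> m g \<longleftrightarrow> matrix_chain (point_kernel E A \<mu>) (point_shift E A \<mu>) m g"
proof -
  have "(\<forall>j. 1 \<le> j \<and> j \<le> m - 1 \<longrightarrow> P j (j - 1)) \<longleftrightarrow> (\<forall>j. Suc j < m \<longrightarrow> P (Suc j) j)"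
    if "1 \<le> m" for P
  proof (intro iffI allI impI)
    fix j assume "\<forall>j. 1 \<le> j \<and> j \<le> m - 1 \<longrightarrow> P j (j - 1)" "Suc j < m"
    then show "P (Suc j) j" by (auto dest: spec[of _ "Suc j"])
  next
    fix j assume "\<forall>j. Suc j < m \<longrightarrow> P (Suc j) j" "1 \<le> j \<and> j \<le> m - 1"
    with that show "P j (j - 1)" by (cases j) auto
  qed
  from this[of "\<lambda>i j. point_kernel E A \<mu> *v g i = point_shift E A \<mu> *v g j"]
  show ?thesis by (cases \<mu>) (auto simp: matrix_chain_def)
qed

text \<open>
  Replacing \<open>Y\<close> by \<open>d Y + c X\<close> with \<open>d \<noteq> 0\<close> changes the chains but neither their lengths nor the
  subspaces they fill; hence \<open>Y\<close> may be taken invertible.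
\<close>

locale local_pencil =
  fixes X Y N R :: "'a::field^'n^'n" and c d :: 'a
  assumes RN: "R ** N = X" and R: "invertible R" and R_eq: "\<And>x. R *v x = d *s (Y *v x) + c *s (X *v x)"
    and d: "d \<noteq> 0"
begin

text \<open>Substitute d Y = R - c X and cancel R. The chain recursion becomes d N x = (1 - c N) y,
  in terms of N alone; N is nilpotent on its iterated kernels, so 1 - c N is invertible
  there.\<close>

lemma chain_eq_iff: "X *v x = Y *v y \<longleftrightarrow> d *s (N *v x) = y - c *s (N *v y)"
proof -
  have "X *v x = Y *v y \<longleftrightarrow> d *s (X *v x) = d *s (Y *v y)" using d by simp
  also have "d *s (Y *v y) = R *v y - c *s (X *v y)" by (simp add: R_eq)
  also have "d *s (X *v x) = R *v (d *s (N *v x))"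
    by (simp add: RN[symmetric] matrix_vector_mul_assoc vector_scalar_commute)
  also have "R *v y - c *s (X *v y) = R *v (y - c *s (N *v y))"
    by (simp add: RN[symmetric] matrix_vector_mul_assoc vector_scalar_commute matrix_vector_mult_diff_distrib)
  also have "R *v (d *s (N *v x)) = R *v (y - c *s (N *v y)) \<longleftrightarrow> d *s (N *v x) = y - c *s (N *v y)"
    using R by (metis invertible_def matrix_vector_mul_assoc matrix_vector_mul_lid)
  finally show ?thesis .
qed

lemma X_zero_iff: "X *v x = 0 \<longleftrightarrow> N *v x = 0"
  using chain_eq_iff[of x 0] d by (simp add: matrix_vector_mult_0_right)

text \<open>Up to the factor d, N sends each chain vector to its predecessor minus a term one level
  lower, so the level rises by exactly one along the chain.\<close>

lemma chain_iter_kernel: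
  assumes "matrix_chain X Y m g" "j < m"
  shows "g j \<in> iter_kernel N (Suc j) - iter_kernel N j"
  using assms(2)
proof (induction j)
  case 0
  then show ?case using assms(1) by (simp add: matrix_chain_def iter_kernel_def X_zero_iff)
next
  case (Suc j)
  have eq: "d *s (N *v g (Suc j)) = g j - c *s (N *v g j)"
    using assms(1) Suc.prems by (simp add: matrix_chain_def chain_eq_iff)
  have gj: "g j \<in> iter_kernel N (Suc j)" "g j \<notin> iter_kernel N j" using Suc by auto
  then have Ng: "c *s (N *v g j) \<in> iter_kernel N j"
    by (intro vec.subspace_scale subspace_iter_kernel) (simp add: iter_kernel_Suc)
  have 1: "d *s (N *v g (Suc j)) \<in> iter_kernel N (Suc j)"
    unfolding eq using gj(1) Ng iter_kernel_mono[of j "Suc j" N]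
    by (intro vec.subspace_diff[OF subspace_iter_kernel]) auto
  have 2: "d *s (N *v g (Suc j)) \<notin> iter_kernel N j"
  proof
    assume "d *s (N *v g (Suc j)) \<in> iter_kernel N j"
    then have "(g j - c *s (N *v g j)) + c *s (N *v g j) \<in> iter_kernel N j"
      unfolding eq by (intro vec.subspace_add[OF subspace_iter_kernel] Ng)
    then show False using gj(2) by simp
  qed
  have "N *v g (Suc j) \<in> iter_kernel N k \<longleftrightarrow> d *s (N *v g (Suc j)) \<in> iter_kernel N k" for k
    using vec.subspace_scale[OF subspace_iter_kernel, of "d *s (N *v g (Suc j))" N k "inverse d"]
      vec.subspace_scale[OF subspace_iter_kernel, of "N *v g (Suc j)" N k d] d
    by auto
  then show ?case using 1 2 iter_kernel_Suc by blast
qed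

text \<open>Surjectivity of 1 - c N on an iterated kernel. The Neumann series is unrolled by
  induction: if y is a preimage of N z, then z + c y is a preimage of z.\<close>

lemma exists_shift_preimage:
  "z \<in> iter_kernel N k \<Longrightarrow> \<exists>y\<in>iter_kernel N k. y - c *s (N *v y) = z"
proof (induction k arbitrary: z)
  case 0
  then show ?case by (intro bexI[of _ z]) (simp_all add: iter_kernel_def matrix_vector_mult_0_right)
next
  case (Suc k)
  then obtain y where y: "y \<in> iter_kernel N k" "y - c *s (N *v y) = N *v z"
    unfolding iter_kernel_Suc by blast
  have "z + c *s y - c *s (N *v (z + c *s y)) = z + c *s (y - c *s (N *v y)) - c *s (N *v z)"
    by (simp add: matrix_vector_right_distrib vector_scalar_commute vec.scale_right_distrib vec.scale_right_diff_distrib)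
  also have "\<dots> = z" by (simp add: y)
  finally show ?case
    using Suc.prems y(1) iter_kernel_mono[of k "Suc k" N] subspace_iter_kernel[of N "Suc k"]
    by (intro bexI[of _ "z + c *s y"] vec.subspace_add vec.subspace_scale) auto
qed

text \<open>The chain is built backwards from its last vector: solving (1 - c N) y = d N x gives a
  predecessor one level lower, and a zero predecessor means that x alone is a chain.\<close>

lemma iter_kernel_chain:
  "x \<in> iter_kernel N k \<Longrightarrow> x \<noteq> 0 \<Longrightarrow> \<exists>m g. matrix_chain X Y m g \<and> g (m - 1) = x"
proof (induction k arbitrary: x)
  case 0
  then show ?case by (simp add: iter_kernel_def)
next
  case (Suc k)
  have "d *s (N *v x) \<in> iter_kernel N k"
    using Suc.prems by (simp add: iter_kernel_Suc subspace_iter_kernel vec.subspace_scale)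
  then obtain y where y: "y \<in> iter_kernel N k" "X *v x = Y *v y"
    using exists_shift_preimage chain_eq_iff by metis
  show ?case
  proof (cases "y = 0")
    case True
    then have "matrix_chain X Y 1 (\<lambda>_. x)"
      using y Suc.prems by (simp add: matrix_chain_def matrix_vector_mult_0_right)
    then show ?thesis by fastforce
  next
    case False
    then obtain m g where g: "matrix_chain X Y m g" "g (m - 1) = y"
      using Suc.IH y by blast
    then have "matrix_chain X Y (Suc m) (g(m := x))"
      using y by (auto simp: matrix_chain_def less_Suc_eq)
    then show ?thesis by (metis diff_Suc_1 fun_upd_same)
  qed
qed

text \<open>The chain vectors witness that the first m iterated kernels increase strictly, so their
  dimensions grow by at least one each time.\<close>

lemma chain_length_le:
  assumes "matrix_chain X Y m g"
  shows "m \<le> CARD('n)"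
proof -
  have "j \<le> m \<Longrightarrow> j \<le> vec.dim (iter_kernel N j)" for j
  proof (induction j)
    case (Suc j)
    have "iter_kernel N j \<subset> iter_kernel N (Suc j)"
      using chain_iter_kernel[OF assms, of j] Suc.prems iter_kernel_mono[of j "Suc j" N] by auto
    then have "vec.dim (iter_kernel N j) < vec.dim (iter_kernel N (Suc j))"
      using subspace_iter_kernel vec.dim_psubset by (metis vec.span_eq_iff)
    then show ?case using Suc by simp
  qed simp
  then show ?thesis
    by (meson dim_subset_UNIV_cart_gen le_refl order_trans)
qed

text \<open>Any bound \<open>K\<close> is allowed because it is taken later as the dimension, as
  something larger, and as the length of the longest chain.\<close>

lemma chain_elements:
  assumes "\<And>m g. matrix_chain X Y m g \<Longrightarrow> m \<le> K"
  shows "{0} \<union> {g j | g j m. matrix_chain X Y m g \<and> j < m} = iter_kernel N K"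
proof (intro equalityI subsetI)
  fix x assume "x \<in> {0} \<union> {g j | g j m. matrix_chain X Y m g \<and> j < m}"
  then consider "x = 0" | g j m where "x = g j" "matrix_chain X Y m g" "j < m" by auto
  then show "x \<in> iter_kernel N K"
  proof cases
    case 1
    then show ?thesis by (simp add: subspace_iter_kernel vec.subspace_0)
  next
    case 2
    then show ?thesis
      using chain_iter_kernel[of m g j] assms[of m g] iter_kernel_mono[of "Suc j" K N] by auto
  qed
next
  fix x assume "x \<in> iter_kernel N K"
  then show "x \<in> {0} \<union> {g j | g j m. matrix_chain X Y m g \<and> j < m}"
  proof (cases "x = 0")
    case False
    then obtain m g where "matrix_chain X Y m g" "g (m - 1) = x"
      using iter_kernel_chain \<open>x \<in> iter_kernel N K\<close> by blast
    moreover then have "m - 1 < m" by (simp add: matrix_chain_def)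
    ultimately show ?thesis by blast
  qed simp
qed

end

section \<open>Pencils of rank one\<close>

definition dot_product :: "'a::field^'n \<Rightarrow> 'a^'n \<Rightarrow> 'a" where
  "dot_product w x = (\<Sum>j\<in>UNIV. w $ j * x $ j)"

lemma linear_dot_product: "Vector_Spaces.linear (*s) (*) (dot_product w)"
  by unfold_locales
    (simp_all add: dot_product_def algebra_simps sum.distrib sum_distrib_left)

definition outer :: "'a::field^'n \<Rightarrow> 'a^'n \<Rightarrow> 'a^'n^'n" where
  "outer u w = (\<chi> i j. u $ i * w $ j)"

lemma outer_mult_vec: "outer u w *v x = dot_product w x *s u"
  by (simp add: outer_def dot_product_def matrix_vector_mult_def vec_eq_iff sum_distrib_left mult_ac)

lemma mat_mult_nth: "(mat c ** M) $ i $ j = c * M $ i $ j"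
  by (simp add: matrix_matrix_mult_def mat_def if_distrib[of "\<lambda>x. x * _"] cong: if_cong)

lemma mat_mult_vec: "(mat c ** M) *v x = c *s (M *v x)"
  by (simp add: vec_eq_iff matrix_vector_mult_def mat_mult_nth sum_distrib_left mult.assoc)

lemma minor_2:
  assumes "i \<noteq> i'" "j \<noteq> j'"
  shows "minor M 2 (\<lambda>k. if k = 0 then i else i') (\<lambda>k. if k = 0 then j else j')
    = M $ i $ j * M $ i' $ j' - M $ i $ j' * M $ i' $ j"
proof -
  let ?t = "Transposition.transpose 0 (1::nat)"
  have 2: "{..<2::nat} = {0, 1}" by auto
  have "p permutes {0, 1} \<longleftrightarrow> p = id \<or> p = ?t" for p :: "nat \<Rightarrow> nat"
    by (rule permutes_doubleton_iff)
  then have "{p. p permutes {..<2::nat}} = {id, ?t}" by (auto simp: 2)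
  moreover have "id \<noteq> ?t" by (metis id_apply transpose_apply_first zero_neq_one)
  ultimately show ?thesis
    by (simp add: minor_def 2 sign_swap_id sign_id)
qed

text \<open>A nonzero 2 by 2 minor would put 2 into a set with maximum 1. That set is finite because
  rows are chosen injectively. For equal rows or columns the identity is mere commutativity.\<close>

lemma minor_rank_1D:
  fixes M :: "'a::comm_ring_1^'n^'n"
  assumes "minor_rank M = 1"
  shows "M $ i $ j * M $ i' $ j' = M $ i $ j' * M $ i' $ j"
proof (cases "i = i' \<or> j = j'")
  case False
  let ?f = "\<lambda>i i' k. if k = 0 then i else i' :: 'n"
  let ?S = "{r. \<exists>f g. inj_on f {..<r} \<and> inj_on g {..<r} \<and> minor M r f g \<noteq> 0}"
  have "?S \<subseteq> {..CARD('n)}"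
  proof
    fix r assume "r \<in> ?S"
    then obtain f :: "nat \<Rightarrow> 'n" where "inj_on f {..<r}" by blast
    then have "card {..<r} \<le> CARD('n)"
      by (intro card_inj_on_le[of f]) auto
    then show "r \<in> {..CARD('n)}" by simp
  qed
  then have fin: "finite ?S" by (rule finite_subset) simp
  have inj: "inj_on (?f k k') {..<2::nat}" if "k \<noteq> k'" for k k'
    using that by (auto simp: inj_on_def)
  have "2 \<notin> ?S"
    using Max_ge[OF fin, of 2] assms by (auto simp: minor_rank_def)
  then have "minor M 2 (?f i i') (?f j j') = 0"
    using inj[of i i'] inj[of j j'] False by blast
  then show ?thesis using minor_2[of i i' j j' M] False by simp
qed (auto simp: mult.commute)

lemma outerI:
  fixes M :: "'a::field^'n^'n"
  assumes "\<And>i i' j j'. M $ i $ j * M $ i' $ j' = M $ i $ j' * M $ i' $ j"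
  shows "\<exists>u w. M = outer u w"
proof (cases "M = 0")
  case True
  then have "M = outer 0 0" by (simp add: outer_def vec_eq_iff)
  then show ?thesis by blast
next
  case False
  then obtain i j where ij: "M $ i $ j \<noteq> 0" by (auto simp: vec_eq_iff)
  have "M = outer (\<chi> k. M $ k $ j) (\<chi> l. M $ i $ l / M $ i $ j)"
    using assms[of _ _ i j] ij by (simp add: outer_def vec_eq_iff field_simps)
  then show ?thesis by blast
qed

lemma parallelI:
  fixes p r :: "'a::field^'n"
  assumes "\<And>i i'. p $ i * r $ i' = r $ i * p $ i'" "p \<noteq> 0"
  shows "\<exists>c. r = c *s p"
proof -
  obtain i where "p $ i \<noteq> 0" using assms(2) by (auto simp: vec_eq_iff)
  then have "r = (r $ i / p $ i) *s p"
    using assms(1)[of i] by (simp add: vec_eq_iff field_simps)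
  then show ?thesis by blast
qed

text \<open>The vanishing 2 by 2 minors are polynomials in s. Their outer coefficients make F and G
  outer products; the mixed coefficient forces the two to share a left or a right factor.\<close>

lemma rank_one_pencil:
  fixes F G :: "complex^'n^'n"
  assumes "pencil_rank F G = 1"
  shows "(\<exists>u v w. F = outer u w \<and> G = outer v w) \<or> (\<exists>u v w. F = outer w u \<and> G = outer w v)"
proof -
  have M: "F $ i $ j * F $ i' $ j' = F $ i $ j' * F $ i' $ j"
    "G $ i $ j * G $ i' $ j' = G $ i $ j' * G $ i' $ j"
    "F $ i $ j * G $ i' $ j' + G $ i $ j * F $ i' $ j' = F $ i $ j' * G $ i' $ j + G $ i $ j' * F $ i' $ j"
    for i j i' j'
  proof -
    have "[:- G $ i $ j, F $ i $ j:] * [:- G $ i' $ j', F $ i' $ j':]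
      = [:- G $ i $ j', F $ i $ j':] * [:- G $ i' $ j, F $ i' $ j:]"
      using minor_rank_1D[of "pencil F G" i j i' j'] assms
      by (simp add: pencil_rank_def pencil_def monom_Suc monom_0)
    then show "F $ i $ j * F $ i' $ j' = F $ i $ j' * F $ i' $ j"
      "G $ i $ j * G $ i' $ j' = G $ i $ j' * G $ i' $ j"
      "F $ i $ j * G $ i' $ j' + G $ i $ j * F $ i' $ j' = F $ i $ j' * G $ i' $ j + G $ i $ j' * F $ i' $ j"
      by (simp_all add: add_eq_0_iff algebra_simps)
  qed
  obtain p q where F: "F = outer p q" using outerI[of F] M(1) by blast
  obtain r t where G: "G = outer r t" using outerI[of G] M(2) by blast
  have zero: "outer 0 x = 0" "outer x 0 = 0" for x :: "complex^'n"
    by (simp_all add: outer_def vec_eq_iff)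
  show ?thesis
  proof (cases "p = 0 \<or> q = 0")
    \<comment> \<open>Here F = 0, which is an outer product with any right factor, in particular
      that of G.\<close>
    case True
    then have "F = outer 0 t" using F zero by auto
    then show ?thesis using G by blast
  next
    case False
    \<comment> \<open>The mixed coefficient factors into a minor of the left vectors p, r and one of
      the right vectors q, t, with independent indices; so one family vanishes entirely.\<close>
    have prod: "(p $ i * r $ i' - r $ i * p $ i') * (q $ j * t $ j' - t $ j * q $ j') = 0" for i i' j j'
      using M(3)[of i j i' j'] by (simp add: F G outer_def algebra_simps)
    consider "\<And>i i'. p $ i * r $ i' = r $ i * p $ i'" | "\<And>j j'. q $ j * t $ j' = t $ j * q $ j'"
      using prod by (metis eq_iff_diff_eq_0 mult_eq_0_iff)
    then show ?thesis
    proof cases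
      case 1
      then obtain c where "r = c *s p" using parallelI False by blast
      then have "G = outer p (c *s t)" by (simp add: G outer_def vec_eq_iff)
      then show ?thesis using F by blast
    next
      case 2
      then obtain c where "t = c *s q" using parallelI False by blast
      then have "G = outer (c *s r) q" by (simp add: G outer_def vec_eq_iff)
      then show ?thesis using F by blast
    qed
  qed
qed

lemma rank_one_agreement:
  fixes X R N N' :: "'a::field^'n^'n"
  assumes N: "R ** N = X" and N': "(R + \<Delta>R) ** N' = X + \<Delta>X"
    and inv: "invertible R" "invertible (R + \<Delta>R)"
    and rank: "(\<exists>u v w. \<Delta>X = outer u w \<and> \<Delta>R = outer v w) \<or> (\<exists>u v w. \<Delta>X = outer w u \<and> \<Delta>R = outer w v)"
  shows "\<exists>\<phi>. Vector_Spaces.linear (*s) (*) \<phi> \<and>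
    (\<forall>x. \<phi> x = 0 \<longrightarrow> \<phi> (N *v x) = 0 \<longrightarrow> N' *v x = N *v x)"
proof -
  have inj: "x = y" if "R' *v x = R' *v y" "invertible R'" for R' :: "'a^'n^'n" and x y
    using that by (metis invertible_def matrix_vector_mul_assoc matrix_vector_mul_lid)
  from rank show ?thesis
  proof (elim disjE exE conjE)
    fix u v w assume eq: "\<Delta>X = outer u w" "\<Delta>R = outer v w"
    \<comment> \<open>With a common right factor w, the perturbations vanish at x and at N x, so N x
      already solves the perturbed equation.\<close>
    have "N' *v x = N *v x" if "dot_product w x = 0" "dot_product w (N *v x) = 0" for x
    proof (rule inj[OF _ inv(2)])
      have "(R + \<Delta>R) *v (N' *v x) = X *v x"
        by (simp add: matrix_vector_mul_assoc N') (simp add: eq matrix_vector_mult_add_rdistrib outer_mult_vec that)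
      also have "\<dots> = (R + \<Delta>R) *v (N *v x)"
        by (simp add: eq matrix_vector_mult_add_rdistrib outer_mult_vec that) (simp add: matrix_vector_mul_assoc N)
      finally show "(R + \<Delta>R) *v (N' *v x) = (R + \<Delta>R) *v (N *v x)" .
    qed
    then show ?thesis using linear_dot_product by blast
  next
    fix u v w assume eq: "\<Delta>X = outer w u" "\<Delta>R = outer w v"
    \<comment> \<open>With a common left factor w, R N' x - R N x is the multiple of w by this
      number, which is linear in x.\<close>
    let ?\<phi> = "\<lambda>x. dot_product u x - dot_product v (N' *v x)"
    have "N' *v x = N *v x" if "?\<phi> x = 0" for x
    proof (rule inj[OF _ inv(1)])
      have "(R + \<Delta>R) *v (N' *v x) = X *v x + \<Delta>X *v x"
        by (simp add: matrix_vector_mul_assoc N' matrix_vector_mult_add_rdistrib)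
      then show "R *v (N' *v x) = R *v (N *v x)"
        using that by (simp add: eq matrix_vector_mult_add_rdistrib outer_mult_vec)
          (simp add: matrix_vector_mul_assoc N)
    qed
    moreover have "Vector_Spaces.linear (*s) (*) ?\<phi>"
    proof -
      interpret u: Vector_Spaces.linear "(*s)" "(*)" "dot_product u" by (rule linear_dot_product)
      interpret v: Vector_Spaces.linear "(*s)" "(*)" "dot_product v" by (rule linear_dot_product)
      show ?thesis
        by unfold_locales
          (simp_all add: u.add v.add u.scale v.scale vec.add vec.scale algebra_simps)
    qed
    ultimately show ?thesis by blast
  qed
qed

section \<open>Root subspaces\<close>

lemma poly_det_pencil: "poly (det (pencil E A)) \<alpha> = det (mat \<alpha> ** E - A)"
  by (simp add: det_def poly_sum poly_prod pencil_def poly_monom mat_mult_nth mult.commute)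

lemma finite_singular:
  assumes "regular_pencil E A"
  shows "finite {\<alpha>. \<not> invertible (mat \<alpha> ** E - A)}"
  using assms poly_roots_finite[of "det (pencil E A)"]
  by (simp add: regular_pencil_def invertible_det_nz poly_det_pencil)

text \<open>Only finitely many values are excluded. One common \<alpha> lets both pencils be
  compared, and avoiding \<open>S\<close> keeps the points of interest different from
  \<alpha>.\<close>

lemma exists_regular_point:
  assumes "regular_pencil E A" "regular_pencil E' A'" "finite S"
  shows "\<exists>\<alpha>. invertible (mat \<alpha> ** E - A) \<and> invertible (mat \<alpha> ** E' - A') \<and> Fin \<alpha> \<notin> S"
proof -
  have "finite (Fin -` S)" by (intro finite_vimageI assms) (auto simp: inj_def)
  then have fin: "finite ({\<alpha>. \<not> invertible (mat \<alpha> ** E - A)} \<union> {\<alpha>. \<not> invertible (mat \<alpha> ** E' - A')} \<union> Fin -` S)"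
    using assms by (simp add: finite_singular)
  from ex_new_if_finite[OF infinite_UNIV_char_0 fin] show ?thesis by auto
qed

lemma finite_pencil_spectrum:
  assumes "regular_pencil E A"
  shows "finite (pencil_spectrum E A)"
proof -
  have "{Fin \<mu> |\<mu>. \<not> invertible (mat \<mu> ** E - A)} = Fin ` {\<mu>. \<not> invertible (mat \<mu> ** E - A)}" by auto
  then show ?thesis using finite_singular[OF assms] by (simp add: pencil_spectrum_def)
qed

section \<open>A regular pencil seen from a point where it is invertible\<close>

locale pencil_at_regular_point =
  fixes E A R' :: "complex^'n^'n" and \<alpha> :: complex
  assumes inverse: "(mat \<alpha> ** E - A) ** R' = mat 1" "R' ** (mat \<alpha> ** E - A) = mat 1"
begin

lemma invertible: "invertible (mat \<alpha> ** E - A)"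
  using inverse invertible_def by blast

text \<open>At a finite point m, \<alpha> E - A = (\<alpha> - m) E - (A - m E); at infinity it is
  already a combination of E and A. The coefficient of Y is \<alpha> - m, nonzero by assumption, or
  -1.\<close>

lemma local_pencil_point:
  assumes "\<mu> \<noteq> Fin \<alpha>"
  shows "\<exists>c d. local_pencil (point_kernel E A \<mu>) (point_shift E A \<mu>) (R' ** point_kernel E A \<mu>) (mat \<alpha> ** E - A) c d"
proof -
  have RN: "(mat \<alpha> ** E - A) ** (R' ** point_kernel E A \<mu>) = point_kernel E A \<mu>"
    by (simp add: matrix_mul_assoc inverse matrix_mul_lid)
  show ?thesis
  proof (cases \<mu>)
    case (Fin m)
    then have "local_pencil (point_kernel E A \<mu>) (point_shift E A \<mu>) (R' ** point_kernel E A \<mu>)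
      (mat \<alpha> ** E - A) (-1) (\<alpha> - m)"
      using assms RN invertible
      by unfold_locales
        (simp_all add: matrix_vector_mult_diff_rdistrib mat_mult_vec vec.scale_left_diff_distrib)
    then show ?thesis by blast
  next
    case Infty
    then have "local_pencil (point_kernel E A \<mu>) (point_shift E A \<mu>) (R' ** point_kernel E A \<mu>)
      (mat \<alpha> ** E - A) \<alpha> (-1)"
      using assms RN invertible
      by unfold_locales
        (simp_all add: matrix_vector_mult_diff_rdistrib mat_mult_vec)
    then show ?thesis by blast
  qed
qed

lemma jordan_chain_length_le:
  "\<mu> \<noteq> Fin \<alpha> \<Longrightarrow> jordan_chain E A \<mu> m g \<Longrightarrow> m \<le> CARD('n)"
  using local_pencil_point local_pencil.chain_length_le jordan_chain_iff by metis

lemma root_subspace_eq: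
  assumes "\<mu> \<noteq> Fin \<alpha>" "\<And>m g. jordan_chain E A \<mu> m g \<Longrightarrow> m \<le> K"
  shows "root_subspace E A \<mu> = iter_kernel (R' ** point_kernel E A \<mu>) K"
proof -
  obtain c d where "local_pencil (point_kernel E A \<mu>) (point_shift E A \<mu>)
    (R' ** point_kernel E A \<mu>) (mat \<alpha> ** E - A) c d"
    using local_pencil_point[OF assms(1)] by blast
  from local_pencil.chain_elements[OF this, of K] show ?thesis
    using assms(2) by (simp add: root_subspace_def jordan_chain_iff)
qed

lemma root_subspace_card:
  "\<mu> \<noteq> Fin \<alpha> \<Longrightarrow> root_subspace E A \<mu> = iter_kernel (R' ** point_kernel E A \<mu>) CARD('n)"
  using root_subspace_eq jordan_chain_length_le by blast

lemma iter_kernel_subset_root_subspace: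
  assumes "\<mu> \<noteq> Fin \<alpha>"
  shows "iter_kernel (R' ** point_kernel E A \<mu>) k \<subseteq> root_subspace E A \<mu>"
proof -
  \<comment> \<open>Every upper bound on the chain lengths gives the same kernel, so the exponent
    may be raised to at least k.\<close>
  have "root_subspace E A \<mu> = iter_kernel (R' ** point_kernel E A \<mu>) (max k CARD('n))"
    using assms by (intro root_subspace_eq) (auto dest: jordan_chain_length_le)
  then show ?thesis by (simp add: iter_kernel_mono)
qed

text \<open>The chain lengths form a finite set, so \<open>Max\<close> bounds them. Off the spectrum
  there are no chains, and the bound holds vacuously whatever \<open>Max\<close> of the empty set
  is.\<close>

lemma root_subspace_longest_chain:
  assumes "\<mu> \<noteq> Fin \<alpha>"
  shows "root_subspace E A \<mu> = iter_kernel (R' ** point_kernel E A \<mu>) (longest_chain E A \<mu>)"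
proof (rule root_subspace_eq[OF assms])
  fix m g assume g: "jordan_chain E A \<mu> m g"
  have "{m. \<exists>g. jordan_chain E A \<mu> m g} \<subseteq> {..CARD('n)}"
    using jordan_chain_length_le[OF assms] by auto
  then have "finite {m. \<exists>g. jordan_chain E A \<mu> m g}" by (rule finite_subset) simp
  then show "m \<le> longest_chain E A \<mu>"
    unfolding longest_chain_def using g by (intro Max_ge) auto
qed

section \<open>Root subspaces as kernels of coprime polynomials\<close>

fun point_poly :: "ext_complex \<Rightarrow> complex poly" where
  "point_poly (Fin \<mu>) = [:-1, \<alpha> - \<mu>:]"
| "point_poly Infty = [:0, 1:]"

lemma R'_A: "R' *v (A *v x) = \<alpha> *s (R' *v (E *v x)) - x"
proof -
  have "R' *v ((mat \<alpha> ** E - A) *v x) = x"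
    by (simp add: matrix_vector_mul_assoc inverse)
  then show ?thesis
    by (simp add: matrix_vector_mult_diff_rdistrib matrix_vector_mult_diff_distrib mat_mult_vec
        vector_scalar_commute algebra_simps)
qed

text \<open>With T = R' E one has R' A = \<alpha> T - 1, so R' (A - \<mu> E) = (\<alpha> - \<mu>) T
  - 1 is a linear polynomial in T; at infinity it is T itself.\<close>

lemma iter_kernel_eq_poly_kernel:
  "iter_kernel (R' ** point_kernel E A \<mu>) k = poly_kernel (R' ** E) (point_poly \<mu> ^ k)"
proof -
  have "(R' ** point_kernel E A \<mu>) *v x = poly_apply (R' ** E) (point_poly \<mu>) x" for x
    by (cases \<mu>)
      (simp_all add: matrix_vector_mul_assoc[symmetric, of R'] matrix_vector_mult_diff_rdistrib matrix_vector_mult_diff_distrib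
        mat_mult_vec vector_scalar_commute R'_A vec.scale_left_diff_distrib)
  then have "(*v) (R' ** point_kernel E A \<mu>) = poly_apply (R' ** E) (point_poly \<mu>)" by blast
  then show ?thesis by (simp add: iter_kernel_def poly_kernel_def poly_apply_power)
qed

lemma coprime_point_poly:
  assumes "\<mu> \<noteq> \<nu>" "\<mu> \<noteq> Fin \<alpha>" "\<nu> \<noteq> Fin \<alpha>"
  shows "coprime (point_poly \<mu>) (point_poly \<nu>)"
proof -
  \<comment> \<open>Eliminating the variable leaves the constant a d - b c, which every common
    divisor divides; for distinct points it is nonzero.\<close>
  have lin: "coprime [:a, b:] [:c, d:]" if "a * d - b * c \<noteq> 0" for a b c d :: complex
  proof (rule coprimeI)
    fix r assume "r dvd [:a, b:]" "r dvd [:c, d:]"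
    then have "r dvd smult d [:a, b:] - smult b [:c, d:]"
      by (intro dvd_diff dvd_smult)
    also have "smult d [:a, b:] - smult b [:c, d:] = [:a * d - b * c:]"
      by (simp add: mult.commute)
    finally show "is_unit r" 
      using that by (metis dvd_trans is_unit_const_poly_iff dvd_field_iff is_unit_pCons_iff)
  qed
  show ?thesis
    using assms by (cases \<mu>; cases \<nu>) (auto intro!: lin)
qed

lemma sum_dim_root_subspace:
  assumes "finite S" "Fin \<alpha> \<notin> S"
  shows "(\<Sum>\<mu>\<in>S. vec.dim (root_subspace E A \<mu>)) = vec.dim (poly_kernel (R' ** E) (\<Prod>\<mu>\<in>S. point_poly \<mu> ^ CARD('n)))"
proof -
  have "(\<Sum>\<mu>\<in>S. vec.dim (root_subspace E A \<mu>)) = (\<Sum>\<mu>\<in>S. vec.dim (poly_kernel (R' ** E) (point_poly \<mu> ^ CARD('n))))"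
    using assms by (intro sum.cong refl) (metis root_subspace_card iter_kernel_eq_poly_kernel)
  also have "\<dots> = vec.dim (poly_kernel (R' ** E) (\<Prod>\<mu>\<in>S. point_poly \<mu> ^ CARD('n)))"
    using assms
    by (intro dim_poly_kernel_prod[symmetric])
      (auto simp: coprime_power_left_iff coprime_power_right_iff intro!: coprime_point_poly)
  finally show ?thesis .
qed

lemma root_subspace_outside_spectrum:
  assumes "\<mu> \<notin> pencil_spectrum E A"
  shows "root_subspace E A \<mu> = {0}"
proof -
  have inj: "x = 0" if "invertible M" "M *v x = 0" for M :: "complex^'n^'n" and x
    using that by (metis invertible_def matrix_vector_mul_assoc matrix_vector_mul_lid matrix_vector_mult_0_right)
  have "x = 0" if "point_kernel E A \<mu> *v x = 0" for x
  proof (cases \<mu>)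
    case (Fin m)
    then have "invertible (mat m ** E - A)" using assms by (auto simp: pencil_spectrum_def)
    moreover have "(mat m ** E - A) *v x = 0"
      using that Fin by (simp add: matrix_vector_mult_diff_rdistrib)
    ultimately show ?thesis using inj by blast
  next
    case Infty
    then show ?thesis using assms that inj by (auto simp: pencil_spectrum_def split: if_splits)
  qed
  then have "\<not> jordan_chain E A \<mu> m g" for m g
    by (auto simp: jordan_chain_iff matrix_chain_def)
  then show ?thesis by (simp add: root_subspace_def)
qed

text \<open>The root belonging to a finite point \<mu> is 1 / (\<alpha> - \<mu>), and infinity has
  root 0. Inverting this Moebius map reaches every z.\<close>

lemma exists_point_poly:
  "\<exists>\<mu>. \<mu> \<noteq> Fin \<alpha> \<and> [:-z, 1:] dvd point_poly \<mu>"
proof (cases "z = 0")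
  case True
  then show ?thesis by (intro exI[of _ Infty]) simp
next
  case False
  then have "point_poly (Fin (\<alpha> - 1 / z)) = smult (1 / z) [:-z, 1:]" by simp
  then have "[:-z, 1:] dvd point_poly (Fin (\<alpha> - 1 / z))" by (metis dvd_refl dvd_smult)
  then show ?thesis using False by (intro exI[of _ "Fin (\<alpha> - 1 / z)"]) simp
qed

text \<open>Over the complex numbers an annihilating polynomial of T splits into linear factors,
  each dividing a point polynomial. The product of suitable powers of these therefore kills the
  whole space.\<close>

lemma sum_dim_root_subspace_spectrum:
  assumes "finite (pencil_spectrum E A)"
  shows "CARD('n) \<le> (\<Sum>\<mu>\<in>pencil_spectrum E A. vec.dim (root_subspace E A \<mu>))"
proof -
  obtain p where p: "p \<noteq> 0" "poly_kernel (R' ** E) p = UNIV"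
    using annihilating_poly by blast
  obtain point where point: "\<And>z. point z \<noteq> Fin \<alpha>" "\<And>z. [:-z, 1:] dvd point_poly (point z)"
    using exists_point_poly by metis
  define Z where "Z = {z. poly p z = 0}"
  define S where "S = point ` Z"
  have finZ: "finite Z" unfolding Z_def using p(1) by (rule poly_roots_finite)
  have "p dvd (\<Prod>z\<in>Z. [:-z, 1:] ^ order z p)"
    using complex_poly_decompose[of p] p(1) by (metis Z_def dvd_refl leading_coeff_0_iff smult_dvd)
  \<comment> \<open>The exponents are deliberately generous: \<open>degree p\<close> bounds every
    multiplicity, and one common exponent serves all points.\<close>
  also have "\<dots> dvd (\<Prod>z\<in>Z. (\<Prod>\<mu>\<in>S. point_poly \<mu>) ^ degree p)"
  proof (rule prod_dvd_prod)
    fix z assume z: "z \<in> Z"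
    have "point_poly (point z) dvd (\<Prod>\<mu>\<in>S. point_poly \<mu>)"
      using z finZ by (intro dvd_prodI) (auto simp: S_def)
    then show "[:-z, 1:] ^ order z p dvd (\<Prod>\<mu>\<in>S. point_poly \<mu>) ^ degree p"
      using point(2)[of z] order_degree[OF p(1)]
      by (meson dvd_power_le dvd_trans dvd_power_same le_imp_power_dvd)
  qed
  also have "\<dots> = (\<Prod>\<mu>\<in>S. point_poly \<mu> ^ (degree p * card Z))"
    by (simp add: prod_power_distrib power_mult)
  finally have dvd: "p dvd (\<Prod>\<mu>\<in>S. point_poly \<mu> ^ (degree p * card Z))" .
  let ?k = "degree p * card Z"
  have S: "finite S" "Fin \<alpha> \<notin> S" using finZ point(1) by (auto simp: S_def) metis
  have "CARD('n) = vec.dim (poly_kernel (R' ** E) p)"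
    by (simp only: p vec_dim_card)
  also have "\<dots> \<le> vec.dim (poly_kernel (R' ** E) (\<Prod>\<mu>\<in>S. point_poly \<mu> ^ ?k))"
    by (intro vec.dim_subset poly_kernel_dvd dvd)
  also have "\<dots> = (\<Sum>\<mu>\<in>S. vec.dim (poly_kernel (R' ** E) (point_poly \<mu> ^ ?k)))"
    using S by (intro dim_poly_kernel_prod)
      (auto simp: coprime_power_left_iff coprime_power_right_iff intro!: coprime_point_poly)
  also have "\<dots> \<le> (\<Sum>\<mu>\<in>S. vec.dim (root_subspace E A \<mu>))"
    using S iter_kernel_subset_root_subspace
    by (intro sum_mono vec.dim_subset) (metis iter_kernel_eq_poly_kernel)
  \<comment> \<open>The roots of p may lead to points outside the spectrum, whose root subspaces are
    zero.\<close>
  also have "\<dots> \<le> (\<Sum>\<mu>\<in>pencil_spectrum E A \<union> S. vec.dim (root_subspace E A \<mu>))"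
    using S assms by (intro sum_mono2) auto
  also have "\<dots> = (\<Sum>\<mu>\<in>pencil_spectrum E A. vec.dim (root_subspace E A \<mu>))"
    using S assms by (intro sum.mono_neutral_right) (auto simp: root_subspace_outside_spectrum)
  finally show ?thesis .
qed

end

section \<open>Dimension counts for the pencil and its perturbation\<close>

lemma pencil_at_regular_pointE:
  assumes "invertible (mat \<alpha> ** E - A)"
  obtains R' where "pencil_at_regular_point E A R' \<alpha>"
  using assms by (auto simp: invertible_def pencil_at_regular_point_def)

lemma sum_dim_root_subspace_le:
  fixes E A :: "complex^'n^'n"
  assumes "regular_pencil E A" "finite S"
  shows "(\<Sum>\<mu>\<in>S. vec.dim (root_subspace E A \<mu>)) \<le> CARD('n)"
proof -
  obtain \<alpha> where \<alpha>: "invertible (mat \<alpha> ** E - A)" "Fin \<alpha> \<notin> S"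
    using exists_regular_point[OF assms(1,1,2)] by blast
  obtain R' where "pencil_at_regular_point E A R' \<alpha>"
    using \<alpha>(1) by (rule pencil_at_regular_pointE)
  from pencil_at_regular_point.sum_dim_root_subspace[OF this assms(2) \<alpha>(2)]
  show ?thesis by (simp add: dim_subset_UNIV_cart_gen)
qed

lemma sum_dim_root_subspace_ge:
  fixes E A :: "complex^'n^'n"
  assumes "regular_pencil E A"
  shows "CARD('n) \<le> (\<Sum>\<mu>\<in>pencil_spectrum E A. vec.dim (root_subspace E A \<mu>))"
proof -
  obtain \<alpha> where \<alpha>: "invertible (mat \<alpha> ** E - A)"
    using exists_regular_point[OF assms assms finite.emptyI] by blast
  obtain R' where "pencil_at_regular_point E A R' \<alpha>"
    using \<alpha> by (rule pencil_at_regular_pointE)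
  from pencil_at_regular_point.sum_dim_root_subspace_spectrum[OF this finite_pencil_spectrum[OF assms]]
  show ?thesis .
qed

lemma dim_root_subspace_rank_one:
  fixes E A F G :: "complex^'n^'n"
  assumes reg: "regular_pencil E A" "regular_pencil (E + F) (A + G)" and rank: "pencil_rank F G = 1"
  shows "vec.dim (root_subspace E A \<mu>)
    \<le> vec.dim (root_subspace (E + F) (A + G) \<mu>) + longest_chain E A \<mu>"
proof -
  obtain \<alpha> where \<alpha>: "invertible (mat \<alpha> ** E - A)" "invertible (mat \<alpha> ** (E + F) - (A + G))" "\<mu> \<noteq> Fin \<alpha>"
    using exists_regular_point[OF reg, of "{\<mu>}"] by auto
  obtain S where "pencil_at_regular_point E A S \<alpha>"
    using \<alpha>(1) by (rule pencil_at_regular_pointE)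
  then interpret p: pencil_at_regular_point E A S \<alpha> .
  obtain S' where "pencil_at_regular_point (E + F) (A + G) S' \<alpha>"
    using \<alpha>(2) by (rule pencil_at_regular_pointE)
  then interpret p': pencil_at_regular_point "E + F" "A + G" S' \<alpha> .
  let ?R = "mat \<alpha> ** E - A" and ?\<Delta>R = "mat \<alpha> ** F - G"
  let ?X = "point_kernel E A \<mu>" and ?\<Delta>X = "point_kernel F G \<mu>"
  let ?N = "S ** ?X" and ?N' = "S' ** point_kernel (E + F) (A + G) \<mu>"
  have R: "mat \<alpha> ** (E + F) - (A + G) = ?R + ?\<Delta>R" by (simp add: matrix_add_ldistrib)
  have X: "point_kernel (E + F) (A + G) \<mu> = ?X + ?\<Delta>X" by (cases \<mu>) (simp_all add: matrix_add_ldistrib)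
  have outer1: "mat c ** outer a w - outer b w = outer (c *s a - b) w"
    "outer b w - mat c ** outer a w = outer (b - c *s a) w"
    "mat c ** outer w a - outer w b = outer w (c *s a - b)"
    "outer w b - mat c ** outer w a = outer w (b - c *s a)" for a b w :: "complex^'n" and c
    by (simp_all add: vec_eq_iff mat_mult_nth) (simp_all add: outer_def algebra_simps)
  \<comment> \<open>The perturbations at \<mu> and at \<alpha> are both combinations of F and G, so
    they keep the shared factor.\<close>
  have outers: "(\<exists>u v w. ?\<Delta>X = outer u w \<and> ?\<Delta>R = outer v w) \<or> (\<exists>u v w. ?\<Delta>X = outer w u \<and> ?\<Delta>R = outer w v)"
    using rank_one_pencil[OF rank]
  proof (elim disjE exE conjE)
    fix u v w assume "F = outer u w" "G = outer v w"
    then show ?thesis by (intro disjI1) (cases \<mu>; auto simp: outer1)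
  next
    fix u v w assume "F = outer w u" "G = outer w v"
    then show ?thesis by (intro disjI2) (cases \<mu>; auto simp: outer1)
  qed
  have "?R ** ?N = ?X" by (simp add: matrix_mul_assoc p.inverse)
  moreover have "(?R + ?\<Delta>R) ** ?N' = ?X + ?\<Delta>X"
    using p'.inverse(1) by (simp add: matrix_mul_assoc flip: R X)
  ultimately obtain \<phi> where \<phi>: "Vector_Spaces.linear (*s) (*) \<phi>"
    "\<And>x. \<phi> x = 0 \<Longrightarrow> \<phi> (?N *v x) = 0 \<Longrightarrow> ?N' *v x = ?N *v x"
    using rank_one_agreement[OF _ _ \<alpha>(1) \<alpha>(2)[unfolded R] outers] by blast
  let ?m = "longest_chain E A \<mu>"
  have "vec.dim (root_subspace E A \<mu>) = vec.dim (iter_kernel ?N ?m)"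
    using p.root_subspace_longest_chain[OF \<alpha>(3)] by simp
  also have "\<dots> \<le> vec.dim (iter_kernel ?N' ?m) + ?m"
    using \<phi> by (rule dim_iter_kernel_perturbation)
  \<comment> \<open>The exponent comes from the unperturbed chains and may be too small for the
    perturbed ones, so only an inclusion is available here.\<close>
  also have "\<dots> \<le> vec.dim (root_subspace (E + F) (A + G) \<mu>) + ?m"
    by (intro add_right_mono vec.dim_subset p'.iter_kernel_subset_root_subspace \<alpha>)
  finally show ?thesis .
qed

theorem theorem4p4:
  fixes E A F G :: "complex^'n^'n"
  assumes "regular_pencil E A"
    and "pencil_rank F G = 1"
    and "regular_pencil (E + F) (A + G)"
  shows "(\<forall>\<mu>\<in>pencil_spectrum E A.
       int (vec.dim (root_subspace E A \<mu>)) - int (longest_chain E A \<mu>)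
         \<le> int (vec.dim (root_subspace (E + F) (A + G) \<mu>)) \<and>
       int (vec.dim (root_subspace (E + F) (A + G) \<mu>))
         \<le> int (vec.dim (root_subspace E A \<mu>)) + int (chain_sum E A)
             - int (longest_chain E A \<mu>)) \<and>
    (\<forall>\<mu>. \<mu> \<notin> pencil_spectrum E A \<longrightarrow>
       0 \<le> vec.dim (root_subspace (E + F) (A + G) \<mu>) \<and>
       vec.dim (root_subspace (E + F) (A + G) \<mu>) \<le> chain_sum E A) \<and>
    (\<Sum>\<mu>\<in>pencil_spectrum E A. int (vec.dim (root_subspace (E + F) (A + G) \<mu>)))
      \<ge> int CARD('n) - int (chain_sum E A) \<and>
    (\<Sum>\<mu>\<in>pencil_spectrum (E + F) (A + G) - pencil_spectrum E A.
       vec.dim (root_subspace (E + F) (A + G) \<mu>)) \<le> chain_sum E A"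
proof -
  define d where "d = (\<lambda>\<mu>. int (vec.dim (root_subspace E A \<mu>)))"
  define d' where "d' = (\<lambda>\<mu>. int (vec.dim (root_subspace (E + F) (A + G) \<mu>)))"
  define m where "m = (\<lambda>\<mu>. int (longest_chain E A \<mu>))"
  define \<sigma> where "\<sigma> = pencil_spectrum E A"
  have fin: "finite \<sigma>" "finite (pencil_spectrum (E + F) (A + G))"
    unfolding \<sigma>_def using assms by (auto intro: finite_pencil_spectrum)
  have M: "int (chain_sum E A) = sum m \<sigma>"
    by (simp add: chain_sum_def m_def \<sigma>_def)
  have lower: "d \<mu> - m \<mu> \<le> d' \<mu>" for \<mu>
    using dim_root_subspace_rank_one[OF assms(1,3,2), of \<mu>] by (simp add: d_def d'_def m_def)
  have upper: "sum d' S \<le> int CARD('n)" if "finite S" for S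
    using sum_dim_root_subspace_le[OF assms(3) that] unfolding d'_def
    by (metis of_nat_le_iff of_nat_sum)
  have total: "int CARD('n) \<le> sum d \<sigma>"
    using sum_dim_root_subspace_ge[OF assms(1)] unfolding d_def \<sigma>_def
    by (metis of_nat_le_iff of_nat_sum)
  \<comment> \<open>All perturbed dimensions together are at most n, while those on \<sigma> lose at
    most M from a total of at least n; so at most M is left for points off \<sigma>.\<close>
  have rest: "sum d' S \<le> sum m \<sigma>" if "finite S" "S \<inter> \<sigma> = {}" for S
  proof -
    have "sum d' S + sum d' \<sigma> \<le> sum d \<sigma>"
      using upper[of "S \<union> \<sigma>"] that fin total by (simp add: sum.union_disjoint)
    moreover have "sum d \<sigma> - sum m \<sigma> \<le> sum d' \<sigma>"
      unfolding sum_subtractf[symmetric] by (intro sum_mono lower)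
    ultimately show ?thesis by simp
  qed
  \<comment> \<open>The same count with \<mu> singled out: it can gain only what the other points of
    \<sigma> lose, at most M minus its own chain length.\<close>
  have bound: "d' \<mu> \<le> d \<mu> + sum m \<sigma> - m \<mu>" if "\<mu> \<in> \<sigma>" for \<mu>
  proof -
    have "sum d (\<sigma> - {\<mu>}) - sum m (\<sigma> - {\<mu>}) \<le> sum d' (\<sigma> - {\<mu>})"
      unfolding sum_subtractf[symmetric] by (intro sum_mono lower)
    then show ?thesis
      using upper[OF fin(1)] total that fin(1) by (simp add: sum.remove)
  qed
  have "d' \<mu> \<le> sum m \<sigma>" if "\<mu> \<notin> \<sigma>" for \<mu>
    using rest[of "{\<mu>}"] that by simp
  moreover have "sum d' \<sigma> \<ge> int CARD('n) - sum m \<sigma>"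
  proof -
    have "sum d \<sigma> - sum m \<sigma> \<le> sum d' \<sigma>"
      unfolding sum_subtractf[symmetric] by (intro sum_mono lower)
    then show ?thesis using total by simp
  qed
  moreover have "sum d' (pencil_spectrum (E + F) (A + G) - \<sigma>) \<le> sum m \<sigma>"
    using fin by (intro rest) auto
  ultimately show ?thesis
    using lower bound
    unfolding M[symmetric] unfolding d_def d'_def m_def \<sigma>_def
    by (simp flip: of_nat_sum)
qed

end
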